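(* Let $a,b,c,\ell$ be positive integers. There are bijections among the three sets $\mathcal{L}_{([a]\times[b])\times[\ell]}(R^{a+b+c-1})$, $\mathcal{L}_{([a]\times[c])\times[\ell]}(R^{a+b+c-1})$ and $\mathcal{L}_{([b]\times[c])\times[\ell]}(R^{a+b+c-1})$ that are equivariant with respect to promotion, i.e. each bijection $\Psi$ satisfies $\Psi\circ\mathrm{Pro}=\mathrm{Pro}\circ\Psi$.
   Context: For a finite poset $P$ and positive integer $\ell$, let $[\ell]=\{1<\dots<\ell\}$ and for $p\in P$ let the fiber be $F_p=\{(p,i):1\le i\le \ell\}$. Given $R$ assigning to each $p\in P$ a finite nonempty set $R(p)\subset\mathbb{Z}$, a $P$-strict labeling of $P\times[\ell]$ with restriction function $R$ is a map $f:P\times[\ell]\to\mathbb{Z}$ with (1) $f(p_1,i)<f(p_2,i)$ whenever $p_1<_P p_2$; (2) $f(p,i_1)\le f(p,i_2)$ whenever $i_1\le i_2$; (3) $f(p,i)\in R(p)$. The set of these is $\mathcal{L}_{P\times[\ell]}(R)$. For a positive integer $q$, $R^q(p)$ is the set of $k$ such that some map $g:P\to\{1,\dots,q\}$ with $g(p_1)<g(p_2)$ whenever $p_1<_Pp_2$ has $g(p)=k$. Products of chains carry the componentwise order. Promotion: let $R(p)_{>k}$ be the smallest element of $R(p)$ larger than $k$. A label $f(p,i)$ is raisable (resp. lowerable) if there is $g\in\mathcal{L}_{P\times[\ell]}(R)$ with $f(p,i)<g(p,i)$ (resp. $>$) and $f(p',i')=g(p',i')$ for all $(p',i')$ with $p'\neq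 p$. The Bender–Knuth involution $\rho_k$: call raisable labels equal to $k$ and lowerable labels equal to $R(p)_{>k}$ free; if the free labels in fiber $F_p$ are $\alpha$ copies of $k$ followed by $\beta$ copies of $R(p)_{>k}$, $\rho_k$ replaces them by $\beta$ copies of $k$ followed by $\alpha$ copies of $R(p)_{>k}$. Promotion is $\mathrm{Pro}=\cdots\circ\rho_2\circ\rho_1\circ\cdots$ (applied in increasing order of $k$; only finitely many act nontrivially). *)

theory Defs
  imports Main "HOL-Library.FuncSet" "HOL-Library.Product_Order"
begin

text \<open>A finite poset is a finite subset \<^term>\<open>P\<close> of an order type, with the induced order.
  Labelings are \<^const>\<open>extensional\<close>: they are \<^const>\<open>undefined\<close> outside \<open>P \<times> {1..l}\<close>, so that
  distinct elements of the set below are distinct maps on \<open>P \<times> [l]\<close>.\<close>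

definition strict_labelings :: "'p::order set \<Rightarrow> nat \<Rightarrow> ('p \<Rightarrow> int set) \<Rightarrow> ('p \<times> nat \<Rightarrow> int) set" where
  "strict_labelings P l R =
    {f \<in> extensional (P \<times> {1..l}).
      (\<forall>p1\<in>P. \<forall>p2\<in>P. \<forall>i\<in>{1..l}. p1 < p2 \<longrightarrow> f (p1, i) < f (p2, i)) \<and>
      (\<forall>p\<in>P. \<forall>i1\<in>{1..l}. \<forall>i2\<in>{1..l}. i1 \<le> i2 \<longrightarrow> f (p, i1) \<le> f (p, i2)) \<and>
      (\<forall>p\<in>P. \<forall>i\<in>{1..l}. f (p, i) \<in> R p)}"

definition global_restriction :: "'p::order set \<Rightarrow> nat \<Rightarrow> 'p \<Rightarrow> int set" where
  "global_restriction P q p =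
    {k. \<exists>g. g \<in> P \<rightarrow> {1..int q} \<and> (\<forall>p1\<in>P. \<forall>p2\<in>P. p1 < p2 \<longrightarrow> g p1 < g p2) \<and> g p = k}"

definition raisable ::
  "'p::order set \<Rightarrow> nat \<Rightarrow> ('p \<Rightarrow> int set) \<Rightarrow> ('p \<times> nat \<Rightarrow> int) \<Rightarrow> 'p \<Rightarrow> nat \<Rightarrow> bool" where
  "raisable P l R f p i \<longleftrightarrow>
    (\<exists>g \<in> strict_labelings P l R. f (p, i) < g (p, i) \<and>
      (\<forall>p'\<in>P. \<forall>i'\<in>{1..l}. p' \<noteq> p \<longrightarrow> f (p', i') = g (p', i')))"

definition lowerable ::
  "'p::order set \<Rightarrow> nat \<Rightarrow> ('p \<Rightarrow> int set) \<Rightarrow> ('p \<times> nat \<Rightarrow> int) \<Rightarrow> 'p \<Rightarrow> nat \<Rightarrow> bool" where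
  "lowerable P l R f p i \<longleftrightarrow>
    (\<exists>g \<in> strict_labelings P l R. f (p, i) > g (p, i) \<and>
      (\<forall>p'\<in>P. \<forall>i'\<in>{1..l}. p' \<noteq> p \<longrightarrow> f (p', i') = g (p', i')))"

text \<open>\<open>R(p)\<^bsub>>k\<^esub>\<close>; meaningful only if \<^term>\<open>A\<close> has an element larger than \<^term>\<open>k\<close>.\<close>

definition next_label :: "int set \<Rightarrow> int \<Rightarrow> int" where
  "next_label A k = Min {x \<in> A. k < x}"

text \<open>The positions in the fiber of \<^term>\<open>p\<close> with a free label. There are none if \<open>k \<notin> R p\<close> (so
  \<open>\<rho>\<^sub>k\<close> never introduces a label outside \<open>R p\<close>) or if \<open>R p\<close> has no element larger than \<^term>\<open>k\<close>.\<close>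

definition free_positions ::
  "'p::order set \<Rightarrow> nat \<Rightarrow> ('p \<Rightarrow> int set) \<Rightarrow> int \<Rightarrow> ('p \<times> nat \<Rightarrow> int) \<Rightarrow> 'p \<Rightarrow> nat set" where
  "free_positions P l R k f p =
    {i \<in> {1..l}. k \<in> R p \<and> (\<exists>x\<in>R p. k < x) \<and>
      (f (p, i) = k \<and> raisable P l R f p i \<or>
       f (p, i) = next_label (R p) k \<and> lowerable P l R f p i)}"

text \<open>With \<open>\<beta>\<close> the number of free labels \<open>R(p)\<^bsub>>k\<^esub>\<close> in the fiber of \<^term>\<open>p\<close>, the first \<open>\<beta>\<close> free
  positions of the fiber receive \<^term>\<open>k\<close> and the remaining ones receive \<open>R(p)\<^bsub>>k\<^esub>\<close>.\<close>

definition bender_knuth ::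
  "'p::order set \<Rightarrow> nat \<Rightarrow> ('p \<Rightarrow> int set) \<Rightarrow> int \<Rightarrow> ('p \<times> nat \<Rightarrow> int) \<Rightarrow> ('p \<times> nat \<Rightarrow> int)" where
  "bender_knuth P l R k f = (\<lambda>(p, i).
    let F = free_positions P l R k f p;
        \<beta> = card {j \<in> F. f (p, j) = next_label (R p) k}
    in if p \<in> P \<and> i \<in> F
       then (if card {j \<in> F. j < i} < \<beta> then k else next_label (R p) k)
       else f (p, i))"

lemma bender_knuth_trivial:
  assumes "k \<notin> (\<Union>p\<in>P. R p)"
  shows "bender_knuth P l R k f = f"
  using assms by (auto simp: bender_knuth_def free_positions_def Let_def fun_eq_iff)

text \<open>All other \<open>\<rho>\<^sub>k\<close> are the identity by the previous lemma. The smallest index acts first.\<close>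

definition promotion ::
  "'p::order set \<Rightarrow> nat \<Rightarrow> ('p \<Rightarrow> int set) \<Rightarrow> ('p \<times> nat \<Rightarrow> int) \<Rightarrow> ('p \<times> nat \<Rightarrow> int)" where
  "promotion P l R =
    fold (bender_knuth P l R) [Min (\<Union>p\<in>P. R p)..Max (\<Union>p\<in>P. R p)]"

definition promotion_equivariant_bij ::
  "nat \<Rightarrow> 'p::order set \<Rightarrow> ('p \<Rightarrow> int set) \<Rightarrow> 'q::order set \<Rightarrow> ('q \<Rightarrow> int set) \<Rightarrow>
    (('p \<times> nat \<Rightarrow> int) \<Rightarrow> ('q \<times> nat \<Rightarrow> int)) \<Rightarrow> bool" where
  "promotion_equivariant_bij l P R Q S \<Psi> \<longleftrightarrow>
    bij_betw \<Psi> (strict_labelings P l R) (strict_labelings Q l S) \<and>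
    (\<forall>f \<in> strict_labelings P l R. \<Psi> (promotion P l R f) = promotion Q l S (\<Psi> f))"

text \<open>The order on \<^typ>\<open>nat \<times> nat\<close> is the componentwise one from \<^theory>\<open>HOL-Library.Product_Order\<close>.\<close>

definition chain_product :: "nat \<Rightarrow> nat \<Rightarrow> (nat \<times> nat) set" where
  "chain_product a b = {1..a} \<times> {1..b}"

end

theory Submission
  imports Defs
begin

text \<open>Counting the labels above each threshold turns a \<open>P\<close>-strict labeling of \<open>([a] \<times> [b]) \<times> [l]\<close> into an
  order-preserving map \<open>[a] \<times> [b] \<times> [c] \<rightarrow> {0..l}\<close>, and the Bender--Knuth involutions into
  piecewise-linear toggles, so that promotion becomes the sweep that toggles all points in the order of
  their height \<open>i + j - m\<close>. For \<open>[a] \<times> [c]\<close> and \<open>[b] \<times> [c]\<close> the same box is swept by the height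
  \<open>i + m - j\<close> or \<open>j + m - i\<close> instead. The sweeps of two heights whose difference has constant parity
  and which change by \<open>\<plusminus>1\<close> along covers are conjugate: running the toggles in time gives a
  function on space-time, and each sweep advances the slice along its height by two time steps.\<close>

section \<open>Sweeps of piecewise-linear toggles\<close>

text \<open>The bound \<open>a + b + c - 1\<close> makes every label set an interval of
  \<open>c + 1\<close> integers. So each fiber has exactly \<open>c\<close> thresholds, which supply
  the third axis; permuting \<open>a\<close>, \<open>b\<close>, \<open>c\<close> only permutes the
  axes. In a fiber, the free labels fill a window of consecutive positions whose ends are set by the
  neighbouring counts. Exchanging the two multiplicities in the window reflects the count between
  those ends, and this reflection is the toggle. The obstacle is that toggles at neighbouring points
  do not commute, so one sweep order cannot simply be rearranged into another. Parity removes it: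
  when a point is toggled, all its neighbours are at rest, so a neighbour has the same value just
  before and just after that step and may be read at either time. Hence a single evolution contains
  the toggles of every admissible order. Adding an even constant to a height leaves the parities
  alone and moves its slice into the future, where all points have started.\<close>

definition toggle_top :: "'x set \<Rightarrow> ('x \<Rightarrow> 'x \<Rightarrow> bool) \<Rightarrow> int \<Rightarrow> ('x \<Rightarrow> int) \<Rightarrow> 'x \<Rightarrow> int" where
  "toggle_top X E l h x = Min (insert l (h ` {y \<in> X. E x y}))"

definition toggle_bot :: "'x set \<Rightarrow> ('x \<Rightarrow> 'x \<Rightarrow> bool) \<Rightarrow> ('x \<Rightarrow> int) \<Rightarrow> 'x \<Rightarrow> int" where
  "toggle_bot X E h x = Max (insert 0 (h ` {y \<in> X. E y x}))"

definition states :: "'x set \<Rightarrow> ('x \<Rightarrow> 'x \<Rightarrow> bool) \<Rightarrow> int \<Rightarrow> ('x \<Rightarrow> int) set" where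
  "states X E l = {h \<in> X \<rightarrow>\<^sub>E {0..l}. \<forall>x\<in>X. \<forall>y\<in>X. E x y \<longrightarrow> h x \<le> h y}"

text \<open>All points of \<open>D\<close> are toggled at once, from the old values. For an
  independent \<open>D\<close> this agrees with toggling them one by one in any order.\<close>

definition toggle_on ::
  "'x set \<Rightarrow> ('x \<Rightarrow> 'x \<Rightarrow> bool) \<Rightarrow> int \<Rightarrow> 'x set \<Rightarrow> ('x \<Rightarrow> int) \<Rightarrow> ('x \<Rightarrow> int)" where
  "toggle_on X E l D h =
    (\<lambda>x. if x \<in> D then toggle_top X E l h x + toggle_bot X E h x - h x else h x)"

definition height :: "'x set \<Rightarrow> ('x \<Rightarrow> 'x \<Rightarrow> bool) \<Rightarrow> ('x \<Rightarrow> nat) \<Rightarrow> bool" where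
  "height X E u \<longleftrightarrow> (\<forall>x\<in>X. \<forall>y\<in>X. E x y \<longrightarrow> u y = Suc (u x) \<or> u x = Suc (u y))"

definition sweep ::
  "'x set \<Rightarrow> ('x \<Rightarrow> 'x \<Rightarrow> bool) \<Rightarrow> int \<Rightarrow> ('x \<Rightarrow> nat) \<Rightarrow> nat \<Rightarrow> ('x \<Rightarrow> int) \<Rightarrow> ('x \<Rightarrow> int)" where
  "sweep X E l u N = fold (\<lambda>k. toggle_on X E l {x \<in> X. u x = k}) [0..<N]"

definition independent :: "('x \<Rightarrow> 'x \<Rightarrow> bool) \<Rightarrow> 'x set \<Rightarrow> bool" where
  "independent E D \<longleftrightarrow> (\<forall>x\<in>D. \<forall>y\<in>D. \<not> E x y)"

lemma toggle_top_cong: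
  assumes "\<And>y. y \<in> X \<Longrightarrow> E x y \<Longrightarrow> h y = h' y"
  shows "toggle_top X E l h x = toggle_top X E l h' x"
proof -
  have "h ` {y \<in> X. E x y} = h' ` {y \<in> X. E x y}" using assms by (auto simp: image_iff)
  then show ?thesis by (simp add: toggle_top_def)
qed

lemma toggle_bot_cong:
  assumes "\<And>y. y \<in> X \<Longrightarrow> E y x \<Longrightarrow> h y = h' y"
  shows "toggle_bot X E h x = toggle_bot X E h' x"
proof -
  have "h ` {y \<in> X. E y x} = h' ` {y \<in> X. E y x}" using assms by (auto simp: image_iff)
  then show ?thesis by (simp add: toggle_bot_def)
qed

lemma toggle_on_cong:
  assumes "\<And>y. y \<in> X \<Longrightarrow> E x y \<or> E y x \<Longrightarrow> h y = h' y" "h x = h' x" "x \<in> D \<longleftrightarrow> x \<in> D'"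
  shows "toggle_on X E l D h x = toggle_on X E l D' h' x"
  using assms toggle_top_cong[of X E x h h' l] toggle_bot_cong[of X E x h h']
  by (auto simp: toggle_on_def)

lemma toggle_top_le:
  assumes "finite X" "y \<in> X" "E x y"
  shows "toggle_top X E l h x \<le> h y"
  using assms by (auto simp: toggle_top_def intro!: Min_le)

lemma toggle_bot_ge:
  assumes "finite X" "y \<in> X" "E y x"
  shows "h y \<le> toggle_bot X E h x"
  using assms by (auto simp: toggle_bot_def intro!: Max_ge)

lemma toggle_top_le_bound: "finite X \<Longrightarrow> toggle_top X E l h x \<le> l"
  by (auto simp: toggle_top_def intro!: Min_le)

lemma toggle_bot_nonneg: "finite X \<Longrightarrow> 0 \<le> toggle_bot X E h x"
  by (auto simp: toggle_bot_def intro!: Max_ge)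

lemma less_toggle_top_iff:
  "finite X \<Longrightarrow> r < toggle_top X E l h x \<longleftrightarrow> r < l \<and> (\<forall>y\<in>X. E x y \<longrightarrow> r < h y)"
  by (auto simp: toggle_top_def)

lemma toggle_bot_le_iff:
  "finite X \<Longrightarrow> toggle_bot X E h x \<le> r \<longleftrightarrow> 0 \<le> r \<and> (\<forall>y\<in>X. E y x \<longrightarrow> h y \<le> r)"
  by (auto simp: toggle_bot_def)

lemma state_bounds:
  assumes "finite X" "h \<in> states X E l" "x \<in> X"
  shows "toggle_bot X E h x \<le> h x" "h x \<le> toggle_top X E l h x"
  using assms by (auto simp: states_def toggle_bot_def toggle_top_def)

lemma state_range: "h \<in> states X E l \<Longrightarrow> x \<in> X \<Longrightarrow> 0 \<le> h x \<and> h x \<le> l"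
  by (fastforce simp: states_def dest: PiE_mem)

text \<open>A point of an independent \<open>D\<close> has all its neighbours outside
  \<open>D\<close>. They keep their values, so the bounds computed from \<open>h\<close> remain the
  right ones after the replacement.\<close>

lemma states_replace:
  assumes fin: "finite X" and h: "h \<in> states X E l" and D: "D \<subseteq> X" "independent E D"
    and w: "\<And>x. x \<in> D \<Longrightarrow> toggle_bot X E h x \<le> w x \<and> w x \<le> toggle_top X E l h x"
  shows "(\<lambda>x. if x \<in> D then w x else h x) \<in> states X E l"
proof -
  have "0 \<le> w x \<and> w x \<le> l" if "x \<in> D" for x
    using w[OF that] toggle_bot_nonneg[OF fin, of E h x] toggle_top_le_bound[OF fin, of E l h x]
    by linarith
  moreover have "w x \<le> h y" if "x \<in> D" "y \<in> X" "E x y" for x y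
    using w[OF that(1)] toggle_top_le[OF fin that(2), of E x l h] that by force
  moreover have "h y \<le> w x" if "x \<in> D" "y \<in> X" "E y x" for x y
    using w[OF that(1)] toggle_bot_ge[OF fin that(2), of E x h] that by force
  ultimately show ?thesis
    using h D by (auto simp: states_def independent_def PiE_def extensional_def)
qed

lemma toggle_on_states:
  assumes "finite X" "h \<in> states X E l" "D \<subseteq> X" "independent E D"
  shows "toggle_on X E l D h \<in> states X E l"
  unfolding toggle_on_def
  by (rule states_replace[OF assms]) (use state_bounds[OF assms(1,2)] assms(3) in force)

text \<open>The bounds at points of \<open>D\<close> come from points outside \<open>D\<close>,
  which do not move; between fixed bounds the toggle is a reflection.\<close>

lemma toggle_on_involution:
  assumes "independent E D"
  shows "toggle_on X E l D (toggle_on X E l D h) = h"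
proof
  fix x
  have "toggle_top X E l (toggle_on X E l D h) x = toggle_top X E l h x" if "x \<in> D"
    by (rule toggle_top_cong) (use assms that in \<open>auto simp: toggle_on_def independent_def\<close>)
  moreover have "toggle_bot X E (toggle_on X E l D h) x = toggle_bot X E h x" if "x \<in> D"
    by (rule toggle_bot_cong) (use assms that in \<open>auto simp: toggle_on_def independent_def\<close>)
  ultimately show "toggle_on X E l D (toggle_on X E l D h) x = h x"
    by (auto simp: toggle_on_def)
qed

lemma independent_same_parity:
  assumes "height X E u" "D \<subseteq> X" "\<And>x y. x \<in> D \<Longrightarrow> y \<in> D \<Longrightarrow> even (u x) \<longleftrightarrow> even (u y)"
  shows "independent E D"
  using assms unfolding height_def independent_def by (metis even_Suc subsetD)

lemma finite_states:
  assumes "finite X" shows "finite (states X E l)"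
  by (rule finite_subset[of _ "X \<rightarrow>\<^sub>E {0..l}"]) (use assms in \<open>auto simp: states_def intro!: finite_PiE\<close>)

lemma sweep_states:
  assumes "finite X" "height X E u" "h \<in> states X E l"
  shows "sweep X E l u N h \<in> states X E l"
proof (induction N)
  case 0
  then show ?case using assms by (simp add: sweep_def)
next
  case (Suc N)
  have "independent E {x \<in> X. u x = N}"
    by (rule independent_same_parity[OF assms(2)]) auto
  then show ?case using toggle_on_states[OF assms(1) Suc] by (simp add: sweep_def)
qed

subsection \<open>Evolution in time\<close>

text \<open>At time \<open>n\<close> all points that have already started (a point starts at time \<open>u x\<close>) and whose
  height has the parity of \<open>n\<close> are toggled, so that every sweep order sees the same values, only
  read off along a different slice of space-time.\<close>

primrec evolve ::
  "'x set \<Rightarrow> ('x \<Rightarrow> 'x \<Rightarrow> bool) \<Rightarrow> int \<Rightarrow> ('x \<Rightarrow> nat) \<Rightarrow> ('x \<Rightarrow> int) \<Rightarrow> nat \<Rightarrow> ('x \<Rightarrow> int)" where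
  "evolve X E l u h 0 = h"
| "evolve X E l u h (Suc n) =
    toggle_on X E l {x \<in> X. u x \<le> n \<and> even (u x + n)} (evolve X E l u h n)"

text \<open>\<open>u\<close> says when points start to move, \<open>v\<close> at which time each
  point is read. Keeping the two apart allows one evolution to be read along several
  heights.\<close>

definition slice ::
  "'x set \<Rightarrow> ('x \<Rightarrow> 'x \<Rightarrow> bool) \<Rightarrow> int \<Rightarrow> ('x \<Rightarrow> nat) \<Rightarrow> ('x \<Rightarrow> nat) \<Rightarrow> ('x \<Rightarrow> int) \<Rightarrow> ('x \<Rightarrow> int)" where
  "slice X E l u v h = (\<lambda>x. if x \<in> X then evolve X E l u h (v x) x else undefined)"

lemma independent_step:
  "height X E u \<Longrightarrow> independent E {x \<in> X. u x \<le> n \<and> even (u x + n)}"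
  by (rule independent_same_parity[of X E u]) auto

lemma evolve_states:
  assumes "finite X" "height X E u" "h \<in> states X E l"
  shows "evolve X E l u h n \<in> states X E l"
  by (induction n) (simp_all only: evolve.simps, rule assms, rule toggle_on_states[OF assms(1)],
    simp, blast, rule independent_step[OF assms(2)])

lemma evolve_idle: "odd (u x + n) \<Longrightarrow> evolve X E l u h (Suc n) x = evolve X E l u h n x"
  by (simp add: toggle_on_def)

lemma evolve_before: "n \<le> u x \<Longrightarrow> evolve X E l u h n x = h x"
  by (induction n) (auto simp: toggle_on_def)

lemma inj_evolve:
  assumes "height X E u"
  shows "inj (\<lambda>h. evolve X E l u h n)"
proof (induction n)
  case (Suc n)
  have "inj (toggle_on X E l {x \<in> X. u x \<le> n \<and> even (u x + n)})"
    by (rule inj_on_inverseI) (rule toggle_on_involution[OF independent_step[OF assms]])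
  from inj_compose[OF this Suc] show ?case by (simp add: comp_def)
qed simp

section \<open>Slices of space-time and their bijectivity\<close>

lemma height_neighbour:
  assumes "height X E v" "x \<in> X" "y \<in> X" "E x y \<or> E y x"
  shows "v y = Suc (v x) \<or> v x = Suc (v y)"
  using assms by (auto simp: height_def)

text \<open>Neighbours are read one step apart, and the one read later is at rest during that step.
  Both may thus be read at the earlier time, where \<open>evolve\<close> gives a state.\<close>

lemma slice_states:
  assumes fin: "finite X" and u: "height X E u" and v: "height X E v"
    and par: "\<And>x. x \<in> X \<Longrightarrow> even (u x + v x)" and h: "h \<in> states X E l"
  shows "slice X E l u v h \<in> states X E l"
proof -
  note st = evolve_states[OF fin u h]
  have "evolve X E l u h (v x) x \<le> evolve X E l u h (v y) y" if xy: "x \<in> X" "y \<in> X" "E x y" for x y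
  proof -
    have le: "evolve X E l u h n x \<le> evolve X E l u h n y" for n
      using st[of n] xy by (auto simp: states_def)
    have "v y = Suc (v x) \<or> v x = Suc (v y)" using v xy by (auto simp: height_def)
    moreover have "odd (u y + v x)" "odd (u x + v y)"
      using par[OF xy(1)] par[OF xy(2)] calculation by auto
    ultimately show ?thesis using evolve_idle le by metis
  qed
  moreover have "evolve X E l u h n x \<in> {0..l}" if "x \<in> X" for x n
    using st[of n] that by (auto simp: states_def)
  ultimately show ?thesis
    by (auto simp: states_def slice_def PiE_def extensional_def)
qed

text \<open>A slice determines everything after it: by induction on time, the values at all points
  whose reading time has passed are forced. Once all reading times have passed the whole state is
  known, and the evolution can be undone.\<close>

lemma inj_on_slice:
  assumes fin: "finite X" and u: "height X E u" and v: "height X E v"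
    and par: "\<And>x. x \<in> X \<Longrightarrow> even (u x + v x)"
  shows "inj_on (slice X E l u v) (states X E l)"
proof (rule inj_onI)
  fix h h' assume h: "h \<in> states X E l" "h' \<in> states X E l"
    and eq: "slice X E l u v h = slice X E l u v h'"
  have *: "\<forall>x\<in>X. v x \<le> n \<longrightarrow> evolve X E l u h n x = evolve X E l u h' n x" for n
  proof (induction n)
    case 0
    then show ?case using fun_cong[OF eq] by (metis evolve.simps(1) le_zero_eq slice_def)
  next
    case (Suc n)
    show ?case
    proof (intro ballI impI)
      fix x assume x: "x \<in> X" "v x \<le> Suc n"
      show "evolve X E l u h (Suc n) x = evolve X E l u h' (Suc n) x"
      proof (cases "v x = Suc n \<or> odd (u x + n)")
        case True
        then show ?thesis
        proof
          assume "v x = Suc n"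
          then show ?thesis using fun_cong[OF eq, of x] x by (simp add: slice_def)
        next
          assume o: "odd (u x + n)"
          show ?thesis
          proof (cases "v x = Suc n")
            case True
            then show ?thesis using fun_cong[OF eq, of x] x by (simp add: slice_def)
          next
            case False
            then show ?thesis using Suc x evolve_idle[of u x n, OF o] by (metis le_SucE)
          qed
        qed
      next
        case False
        have "evolve X E l u h n y = evolve X E l u h' n y" if y: "y \<in> X" "E x y \<or> E y x" for y
        proof (cases "v y \<le> n")
          case True
          then show ?thesis using Suc y by blast
        next
          case nle: False
          \<comment> \<open>The only neighbours that the induction hypothesis misses are read one
            step later. They rest during step \<open>n\<close>, so their slice value is already
            their value at time \<open>n\<close>.\<close>
          have "v y = Suc n" using height_neighbour[OF v x(1) y] nle x False by auto
          moreover have "odd (u y + n)" using par[OF y(1)] calculation by auto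
          ultimately show ?thesis using fun_cong[OF eq, of y] y evolve_idle
            by (metis slice_def)
        qed
        then show ?thesis unfolding evolve.simps
          by (intro toggle_on_cong) (use False x Suc in auto)
      qed
    qed
  qed
  \<comment> \<open>A time by which every point has been read.\<close>
  define n where "n = Max (insert 0 (v ` X))"
  have "evolve X E l u h n = evolve X E l u h' n"
  proof (rule PiE_ext[of _ X "\<lambda>_. {0..l}"])
    show "evolve X E l u h n \<in> X \<rightarrow>\<^sub>E {0..l}" "evolve X E l u h' n \<in> X \<rightarrow>\<^sub>E {0..l}"
      using evolve_states[OF fin u] h by (auto simp: states_def)
    show "evolve X E l u h n x = evolve X E l u h' n x" if "x \<in> X" for x
      using * fin that by (simp add: n_def)
  qed
  then show "h = h'" by (rule injD[OF inj_evolve[OF u]])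
qed

lemma bij_betw_slice:
  assumes "finite X" "height X E u" "height X E v" "\<And>x. x \<in> X \<Longrightarrow> even (u x + v x)"
  shows "bij_betw (slice X E l u v) (states X E l) (states X E l)"
proof -
  have inj: "inj_on (slice X E l u v) (states X E l)"
    by (rule inj_on_slice) (fact assms)+
  have "slice X E l u v h \<in> states X E l" if "h \<in> states X E l" for h
    by (rule slice_states) (fact assms that)+
  then have "slice X E l u v ` states X E l \<subseteq> states X E l" by blast
  from endo_inj_surj[OF finite_states[OF assms(1)] this inj] inj
  show ?thesis by (simp add: bij_betw_def)
qed

text \<open>When the sweep reaches level \<open>k\<close>, neighbours above are still read at time
  \<open>k + 1\<close> and neighbours below have just moved from \<open>k - 1\<close> to
  \<open>k + 1\<close>. Both kinds rest during step \<open>k\<close>, so the toggle sees exactly the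
  values of time \<open>k\<close> and performs that step of the evolution. The point then rests for
  one more step, which makes the advance two.\<close>

lemma sweep_slice:
  assumes fin: "finite X" and u: "height X E u" and v: "height X E v"
    and par: "\<And>x. x \<in> X \<Longrightarrow> even (u x + v x)" and le: "\<And>x. x \<in> X \<Longrightarrow> u x \<le> v x"
    and N: "\<And>x. x \<in> X \<Longrightarrow> v x < N"
  shows "sweep X E l v N (slice X E l u v h) = slice X E l u (\<lambda>x. v x + 2) h"
proof -
  have step: "evolve X E l u h (v x + 2) x = evolve X E l u h (Suc (v x)) x" if "x \<in> X" for x
    using evolve_idle[of u x "Suc (v x)"] par[OF that] by simp
  have "sweep X E l v k (slice X E l u v h) =
    slice X E l u (\<lambda>x. if v x < k then v x + 2 else v x) h" for k
  proof (induction k)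
    case 0
    then show ?case by (simp add: sweep_def)
  next
    case (Suc k)
    let ?s = "slice X E l u (\<lambda>x. if v x < k then v x + 2 else v x) h"
    have "toggle_on X E l {x \<in> X. v x = k} ?s x =
      slice X E l u (\<lambda>x. if v x < Suc k then v x + 2 else v x) h x" for x
    proof (cases "x \<in> X \<and> v x = k")
      case True
      have "?s y = evolve X E l u h k y" if y: "y \<in> X" "E x y \<or> E y x" for y
      proof -
        have vy: "v y = Suc k \<or> k = Suc (v y)"
          using height_neighbour[OF v _ y] True by auto
        then have odd: "odd (u y + k)" using par[OF y(1)] by auto
        show ?thesis using vy
        proof
          assume "v y = Suc k"
          then show ?thesis using y evolve_idle[of u y k, OF odd] by (simp add: slice_def)
        next
          assume "k = Suc (v y)"
          then show ?thesis using y step[of y] by (simp add: slice_def)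
        qed
      qed
      \<comment> \<open>Here \<open>u x \<le> v x\<close> matters: the point must have started by
        time \<open>k\<close> for the evolution to toggle it as well.\<close>
      then have "toggle_on X E l {x \<in> X. v x = k} ?s x = evolve X E l u h (Suc k) x"
        unfolding evolve.simps
        by (intro toggle_on_cong) (use True par[of x] le[of x] in \<open>auto simp: slice_def\<close>)
      then show ?thesis using True step[of x] by (simp add: slice_def)
    next
      case False
      then show ?thesis by (auto simp: toggle_on_def slice_def)
    qed
    then show ?case using Suc by (auto simp: sweep_def)
  qed
  from this[of N] have "sweep X E l v N (slice X E l u v h) =
    slice X E l u (\<lambda>x. if v x < N then v x + 2 else v x) h" .
  also have "\<dots> = slice X E l u (\<lambda>x. v x + 2) h"
    unfolding slice_def by (rule ext) (use N in \<open>simp split: if_split del: evolve.simps\<close>)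
  finally show ?thesis .
qed

lemma slice_self:
  assumes "h \<in> states X E l"
  shows "slice X E l u u h = h"
proof
  fix x
  show "slice X E l u u h x = h x"
    using assms PiE_arb[of h X "\<lambda>_. {0..l}" x]
    by (simp add: slice_def evolve_before states_def)
qed

text \<open>Evolving from the swept state replays the evolution of \<open>h\<close> two steps ahead.
  Reading this along \<open>v\<close> gives the slice along \<open>v + 2\<close>, which is also what
  a sweep by \<open>v\<close> produces.\<close>

lemma slice_sweep:
  assumes fin: "finite X" and u: "height X E u" and v: "height X E v"
    and par: "\<And>x. x \<in> X \<Longrightarrow> even (u x + v x)" and le: "\<And>x. x \<in> X \<Longrightarrow> u x \<le> v x"
    and N: "\<And>x. x \<in> X \<Longrightarrow> v x < N" and h: "h \<in> states X E l"
  shows "slice X E l u v (sweep X E l u N h) = sweep X E l v N (slice X E l u v h)"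
proof -
  have "sweep X E l u N h = slice X E l u (\<lambda>x. u x + 2) h"
    using sweep_slice[OF fin u u, of N l h] order_le_less_trans[OF le N] slice_self[OF h, of u]
    by simp
  then have sw: "sweep X E l u N h x = evolve X E l u h (u x + 2) x" if "x \<in> X" for x
    using that by (simp add: slice_def)
  \<comment> \<open>The maximum accounts for waiting: until time \<open>u x\<close> the point keeps
    its initial value, which is the value of the old evolution at time
    \<open>u x + 2\<close>.\<close>
  have *: "\<forall>x\<in>X. evolve X E l u (sweep X E l u N h) n x =
    evolve X E l u h (max (u x) n + 2) x" for n
  proof (induction n)
    case 0
    then show ?case using sw by simp
  next
    case (Suc n)
    let ?h' = "sweep X E l u N h"
    show ?case
    proof
      fix x assume x: "x \<in> X"
      consider "Suc n \<le> u x" | "u x \<le> n" "odd (u x + n)" | "u x \<le> n" "even (u x + n)" by linarith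
      then show "evolve X E l u ?h' (Suc n) x = evolve X E l u h (max (u x) (Suc n) + 2) x"
      proof cases
        case 1
        then show ?thesis using sw[OF x] by (simp add: evolve_before max_def del: evolve.simps)
      next
        case 2
        then show ?thesis using Suc x evolve_idle[of u x n] evolve_idle[of u x "n + 2"]
          by (simp add: max_def del: evolve.simps)
      next
        case 3
        have "evolve X E l u ?h' n y = evolve X E l u h (n + 2) y"
          if y: "y \<in> X" "E x y \<or> E y x" for y
        proof (cases "u y \<le> n")
          case True
          then show ?thesis using Suc y by (simp add: max_def)
        next
          case False
          \<comment> \<open>This neighbour has not started, so the induction hypothesis refers to
            time \<open>n + 3\<close>; in the old evolution it rests during step
            \<open>n + 2\<close>.\<close>
          then have "u y = Suc n" using height_neighbour[OF u x y] 3 by auto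
          then show ?thesis using Suc y evolve_idle[of u y "n + 2"]
            by (simp add: max_def del: evolve.simps)
        qed
        then have "evolve X E l u ?h' (Suc n) x = evolve X E l u h (Suc (n + 2)) x"
          unfolding evolve.simps(2)
          by (intro toggle_on_cong) (use 3 x Suc in \<open>auto simp: max_def simp del: evolve.simps\<close>)
        then show ?thesis using 3 by (simp add: max_def del: evolve.simps)
      qed
    qed
  qed
  have "slice X E l u v (sweep X E l u N h) = slice X E l u (\<lambda>x. v x + 2) h"
    unfolding slice_def by (rule ext) (use * le in \<open>simp add: max_absorb2 del: evolve.simps\<close>)
  then show ?thesis using sweep_slice[OF fin u v par le N] by simp
qed

subsection \<open>Equivariant bijections\<close>

definition equivariant :: "'s set \<Rightarrow> ('s \<Rightarrow> 's) \<Rightarrow> 't set \<Rightarrow> ('t \<Rightarrow> 't) \<Rightarrow> bool" where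
  "equivariant A f B g \<longleftrightarrow> (\<exists>\<Psi>. bij_betw \<Psi> A B \<and> (\<forall>x\<in>A. \<Psi> (f x) = g (\<Psi> x)))"

lemma equivariant_trans:
  assumes "equivariant A f B g" "equivariant B g C k"
  shows "equivariant A f C k"
proof -
  obtain \<Psi> \<Phi> where "bij_betw \<Psi> A B" "\<forall>x\<in>A. \<Psi> (f x) = g (\<Psi> x)"
      "bij_betw \<Phi> B C" "\<forall>x\<in>B. \<Phi> (g x) = k (\<Phi> x)"
    using assms by (auto simp: equivariant_def)
  then show ?thesis unfolding equivariant_def
    by (intro exI[of _ "\<Phi> \<circ> \<Psi>"]) (auto intro: bij_betw_trans dest: bij_betwE)
qed

text \<open>The inverse recovers \<open>f x\<close> from its image only if \<open>f x\<close> lies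
  in \<open>A\<close>, hence the closure assumption.\<close>

lemma equivariant_sym:
  assumes "equivariant A f B g" "f \<in> A \<rightarrow> A"
  shows "equivariant B g A f"
proof -
  obtain \<Psi> where \<Psi>: "bij_betw \<Psi> A B" "\<forall>x\<in>A. \<Psi> (f x) = g (\<Psi> x)"
    using assms by (auto simp: equivariant_def)
  have "inv_into A \<Psi> (g y) = f (inv_into A \<Psi> y)" if "y \<in> B" for y
  proof -
    have "inv_into A \<Psi> y \<in> A" "\<Psi> (inv_into A \<Psi> y) = y"
      using \<Psi>(1) that by (auto simp: bij_betw_def inv_into_into f_inv_into_f)
    then show ?thesis
      using \<Psi> assms(2) by (metis bij_betw_inv_into_left funcset_mem)
  qed
  then show ?thesis unfolding equivariant_def using bij_betw_inv_into[OF \<Psi>(1)] by blast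
qed

lemma toggle_on_empty: "toggle_on X E l {} = id"
  by (auto simp: toggle_on_def)

lemma sweep_extend:
  assumes "\<And>x. x \<in> X \<Longrightarrow> u x < N" "N \<le> M"
  shows "sweep X E l u M = sweep X E l u N"
  using assms(2)
proof (induction M rule: dec_induct)
  case (step M)
  have e: "{x \<in> X. u x = M} = {}" using assms(1) step(1) by force
  show ?case using step by (simp add: sweep_def e toggle_on_empty)
qed simp

lemma sweep_shift:
  "sweep X E l (\<lambda>x. u x + d) (d + N) = sweep X E l u N"
proof (induction N)
  case 0
  have "sweep X E l (\<lambda>x. u x + d) M = id" if "M \<le> d" for M
    using that
  proof (induction M)
    case (Suc M)
    then have e: "{x \<in> X. u x + d = M} = {}" by auto
    show ?case using Suc by (simp add: sweep_def e toggle_on_empty)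
  qed (simp add: sweep_def)
  then show ?case by (simp add: sweep_def)
qed (simp add: sweep_def add.commute)

lemma equivariant_sweeps:
  assumes fin: "finite X" and u: "height X E u" and v: "height X E v"
    and par: "\<And>x. x \<in> X \<Longrightarrow> even (u x + v x + d)"
    and N: "\<And>x. x \<in> X \<Longrightarrow> u x < N" and M: "\<And>x. x \<in> X \<Longrightarrow> v x < M"
  shows "equivariant (states X E l) (sweep X E l u N) (states X E l) (sweep X E l v M)"
proof -
  \<comment> \<open>\<open>d\<close> repairs the parity, and the even summand \<open>2 * N\<close>
    lifts the second height above the first without disturbing it.\<close>
  define d' where "d' = d + 2 * N"
  define w where "w = (\<lambda>x. v x + d')"
  have w: "height X E w" using v by (auto simp: height_def w_def)
  have par': "even (u x + w x)" if "x \<in> X" for x using par[OF that] by (auto simp: w_def d'_def)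
  have le: "u x \<le> w x" if "x \<in> X" for x using N[OF that] by (auto simp: w_def d'_def)
  have M': "w x < d' + M" if "x \<in> X" for x using M[OF that] by (auto simp: w_def)
  have "sweep X E l u (d' + M) = sweep X E l u (d' + M + N)"
    by (rule sweep_extend[symmetric]) (use le M' in \<open>force+\<close>)
  also have "\<dots> = sweep X E l u N" by (rule sweep_extend) (use N in auto)
  finally have su: "sweep X E l u (d' + M) = sweep X E l u N" .
  have sv: "sweep X E l w (d' + M) = sweep X E l v M"
    unfolding w_def by (rule sweep_shift)
  have "slice X E l u w (sweep X E l u N h) = sweep X E l v M (slice X E l u w h)"
    if "h \<in> states X E l" for h
    using slice_sweep[OF fin u w par' le M' that] by (simp only: su sv)
  moreover have "bij_betw (slice X E l u w) (states X E l) (states X E l)"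
    by (rule bij_betw_slice[OF fin u w par'])
  ultimately show ?thesis unfolding equivariant_def by blast
qed

lemma equivariant_relabel:
  assumes \<sigma>: "bij_betw \<sigma> X Y" and E: "\<And>x y. x \<in> X \<Longrightarrow> y \<in> X \<Longrightarrow> E x y \<longleftrightarrow> F (\<sigma> x) (\<sigma> y)"
  shows "equivariant (states Y F l) (sweep Y F l u N) (states X E l) (sweep X E l (\<lambda>x. u (\<sigma> x)) N)"
proof -
  define \<Psi> :: "('b \<Rightarrow> int) \<Rightarrow> 'a \<Rightarrow> int" where "\<Psi> h = restrict (h \<circ> \<sigma>) X" for h
  have Y: "Y = \<sigma> ` X" using \<sigma> by (auto simp: bij_betw_def)
  have "bij_betw \<Psi> (states Y F l) (states X E l)"
  proof (rule bij_betw_byWitness[where f' = "\<lambda>h. restrict (h \<circ> inv_into X \<sigma>) Y"])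
    show "\<forall>h\<in>states Y F l. restrict (\<Psi> h \<circ> inv_into X \<sigma>) Y = h"
      using \<sigma> by (auto simp: \<Psi>_def states_def fun_eq_iff bij_betw_inv_into_right
        bij_betw_def inv_into_into f_inv_into_f PiE_def extensional_def)
    show "\<forall>h\<in>states X E l. \<Psi> (restrict (h \<circ> inv_into X \<sigma>) Y) = h"
      using \<sigma> by (auto simp: \<Psi>_def states_def fun_eq_iff bij_betw_def PiE_def extensional_def)
    show "\<Psi> ` states Y F l \<subseteq> states X E l"
      using E Y by (auto simp: \<Psi>_def states_def PiE_def Pi_def)
    show "(\<lambda>h. restrict (h \<circ> inv_into X \<sigma>) Y) ` states X E l \<subseteq> states Y F l"
      using E \<sigma> by (auto simp: states_def PiE_def Pi_def bij_betw_def)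
  qed
  moreover have "\<Psi> (sweep Y F l u N h) = sweep X E l (\<lambda>x. u (\<sigma> x)) N (\<Psi> h)" for h
  proof (induction N)
    case (Suc N)
    have "\<Psi> (toggle_on Y F l {y \<in> Y. u y = N} h) = toggle_on X E l {x \<in> X. u (\<sigma> x) = N} (\<Psi> h)" for h
    proof
      fix x
      have "\<Psi> h ` {y \<in> X. E x y} = h ` {y \<in> Y. F (\<sigma> x) y}"
        "\<Psi> h ` {y \<in> X. E y x} = h ` {y \<in> Y. F y (\<sigma> x)}" if "x \<in> X"
        using E that by (auto simp: \<Psi>_def Y image_iff)
      then show "\<Psi> (toggle_on Y F l {y \<in> Y. u y = N} h) x =
          toggle_on X E l {x \<in> X. u (\<sigma> x) = N} (\<Psi> h) x"
        using Y by (auto simp: toggle_on_def toggle_top_def toggle_bot_def \<Psi>_def)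
    qed
    then show ?case using Suc by (simp add: sweep_def)
  qed (simp add: sweep_def)
  ultimately show ?thesis by (auto simp: equivariant_def)
qed

section \<open>Labelings as order-preserving maps on a box\<close>

definition box :: "nat \<Rightarrow> nat \<Rightarrow> nat \<Rightarrow> ((nat \<times> nat) \<times> nat) set" where
  "box a b c = chain_product a b \<times> {1..c}"

text \<open>Covers instead of the full order: toggles read nearest neighbours only, and the heights
  change by one along each cover.\<close>

fun box_cover :: "(nat \<times> nat) \<times> nat \<Rightarrow> (nat \<times> nat) \<times> nat \<Rightarrow> bool" where
  "box_cover ((i, j), m) ((i', j'), m') \<longleftrightarrow>
    i' = Suc i \<and> j' = j \<and> m' = m \<or> i' = i \<and> j' = Suc j \<and> m' = m \<or> i' = i \<and> j' = j \<and> m' = Suc m"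

abbreviation (input) box_states :: "nat \<Rightarrow> nat \<Rightarrow> nat \<Rightarrow> nat \<Rightarrow> ((nat \<times> nat) \<times> nat \<Rightarrow> int) set" where
  "box_states a b c l \<equiv> states (box a b c) box_cover (int l)"

abbreviation (input) box_restriction :: "nat \<Rightarrow> nat \<Rightarrow> nat \<Rightarrow> nat \<times> nat \<Rightarrow> int set" where
  "box_restriction a b c \<equiv> global_restriction (chain_product a b) (a + b + c - 1)"

text \<open>The Bender--Knuth involution with this index toggles the point.\<close>

fun box_height :: "nat \<Rightarrow> (nat \<times> nat) \<times> nat \<Rightarrow> nat" where
  "box_height c ((i, j), m) = i + j + c - 1 - m"

text \<open>The coordinate \<open>m\<close> is reversed: \<open>h ((i, j), m)\<close> counts the labels \<open>\<ge> i + j + c - m\<close>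
  in the fiber of \<open>(i, j)\<close>, so that \<open>h\<close> is increasing in all three coordinates.\<close>

definition decode ::
  "nat \<Rightarrow> nat \<Rightarrow> nat \<Rightarrow> nat \<Rightarrow> ((nat \<times> nat) \<times> nat \<Rightarrow> int) \<Rightarrow> (nat \<times> nat) \<times> nat \<Rightarrow> int" where
  "decode a b c l h = (\<lambda>(p, t). if p \<in> chain_product a b \<and> t \<in> {1..l}
    then int (fst p + snd p) - 1 + int (card {m \<in> {1..c}. int l < int t + h (p, m)})
    else undefined)"

lemma triple_cases:
  fixes x :: "('a \<times> 'b) \<times> 'c"
  obtains i j m where "x = ((i, j), m)"
  using that[of "fst (fst x)" "snd (fst x)" "snd x"] by simp

lemma finite_box: "finite (box a b c)"
  by (simp add: box_def chain_product_def)

lemma mem_box: "((i, j), m) \<in> box a b c \<longleftrightarrow> i \<in> {1..a} \<and> j \<in> {1..b} \<and> m \<in> {1..c}"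
  by (simp add: box_def chain_product_def)

lemma height_box: "height (box a b c) box_cover (box_height c)"
  by (auto simp: height_def mem_box)

lemma box_cover_irrefl: "\<not> box_cover x x"
proof -
  obtain i j m where "x = ((i, j), m)" by (rule triple_cases)
  then show ?thesis by simp
qed

lemma box_mono_row:
  assumes "h \<in> box_states a b c l" "i \<le> i'" "((i, j), m) \<in> box a b c" "i' \<le> a"
  shows "h ((i, j), m) \<le> h ((i', j), m)"
  using assms(2,4)
proof (induction i' rule: dec_induct)
  case (step n)
  then have "h ((n, j), m) \<le> h ((Suc n, j), m)"
    using assms(1,3) by (auto simp: states_def mem_box)
  then show ?case using step by auto
qed simp

lemma box_mono_column:
  assumes "h \<in> box_states a b c l" "j \<le> j'" "((i, j), m) \<in> box a b c" "j' \<le> b"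
  shows "h ((i, j), m) \<le> h ((i, j'), m)"
  using assms(2,4)
proof (induction j' rule: dec_induct)
  case (step n)
  then have "h ((i, n), m) \<le> h ((i, Suc n), m)"
    using assms(1,3) by (auto simp: states_def mem_box)
  then show ?case using step by auto
qed simp

lemma box_mono_fiber:
  assumes "h \<in> box_states a b c l" "m \<le> m'" "(p, m) \<in> box a b c" "m' \<le> c"
  shows "h (p, m) \<le> h (p, m')"
  using assms(2,4)
proof (induction m' rule: dec_induct)
  case (step n)
  then have "h (p, n) \<le> h (p, Suc n)"
    using assms(1,3) by (cases p) (auto simp: states_def mem_box)
  then show ?case using step by auto
qed simp

text \<open>An up-closed subset of \<open>{1..c}\<close> is a final segment, so its size decides
  membership. This is used both for thresholds in a fiber and for positions in it.\<close>

lemma card_upper_set_ge_iff: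
  assumes "\<And>m m'. m \<in> {1..c} \<Longrightarrow> m \<le> m' \<Longrightarrow> m' \<le> c \<Longrightarrow> Q m \<Longrightarrow> Q m'" and m: "m \<in> {1..c}"
  shows "c + 1 - m \<le> card {m \<in> {1..c}. Q m} \<longleftrightarrow> Q m"
proof
  assume "Q m"
  then have "Q m'" if "m' \<in> {m..c}" for m' using assms(1)[OF m, of m'] that by simp
  then have "{m..c} \<subseteq> {m \<in> {1..c}. Q m}" using m by auto
  from card_mono[OF _ this] show "c + 1 - m \<le> card {m \<in> {1..c}. Q m}" by simp
next
  assume le: "c + 1 - m \<le> card {m \<in> {1..c}. Q m}"
  show "Q m"
  proof (rule ccontr)
    assume "\<not> Q m"
    then have "m < m'" if "m' \<in> {1..c}" "Q m'" for m'
      using assms(1)[OF that(1), of m] that m by (cases "m' \<le> m") auto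
    then have "{m \<in> {1..c}. Q m} \<subseteq> {Suc m..c}" by (auto simp: Suc_le_eq)
    from card_mono[OF _ this] le m show False by (simp add: Suc_diff_le)
  qed
qed

text \<open>Since \<open>h\<close> increases with \<open>m\<close>, the thresholds met at position
  \<open>t\<close> form a final segment of \<open>{1..c}\<close>. Meeting threshold \<open>m\<close>
  means meeting at least \<open>c + 1 - m\<close> of them, and the offset \<open>i + j - 1\<close>
  turns this count into a label.\<close>

lemma decode_ge_iff:
  assumes "h \<in> box_states a b c l" "((i, j), m) \<in> box a b c" "t \<in> {1..l}"
  shows "int (i + j + c) - int m \<le> decode a b c l h ((i, j), t) \<longleftrightarrow> int l < int t + h ((i, j), m)"
proof -
  have "c + 1 - m \<le> card {m \<in> {1..c}. int l < int t + h ((i, j), m)} \<longleftrightarrow>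
      int l < int t + h ((i, j), m)"
  proof (rule card_upper_set_ge_iff)
    show "int l < int t + h ((i, j), m')"
      if "m \<in> {1..c}" "m \<le> m'" "m' \<le> c" "int l < int t + h ((i, j), m)" for m m'
      using box_mono_fiber[OF assms(1) that(2) _ that(3), of "(i, j)"] that assms(2)
      by (simp add: mem_box)
  qed (use assms in \<open>simp add: mem_box\<close>)
  then show ?thesis using assms(2,3) by (auto simp: decode_def mem_box box_def)
qed

lemma decode_bounds:
  assumes "(i, j) \<in> chain_product a b" "t \<in> {1..l}"
  shows "int (i + j) - 1 \<le> decode a b c l h ((i, j), t)"
    and "decode a b c l h ((i, j), t) \<le> int (i + j + c) - 1"
proof -
  have "card {m \<in> {1..c}. int l < int t + h ((i, j), m)} \<le> card {1..c}"
    by (rule card_mono) auto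
  then show "decode a b c l h ((i, j), t) \<le> int (i + j + c) - 1"
    using assms by (simp add: decode_def)
  show "int (i + j) - 1 \<le> decode a b c l h ((i, j), t)"
    using assms by (simp add: decode_def)
qed

lemma less_nat_prod_iff:
  fixes i j i' j' :: nat
  shows "(i, j) < (i', j') \<longleftrightarrow> i \<le> i' \<and> j \<le> j' \<and> i + j < i' + j'"
  by (auto simp: less_le_not_le)

text \<open>A strict map grows by at least one per step, so walking from \<open>(1, 1)\<close> up to
  \<open>(i, j)\<close> and on to \<open>(a, b)\<close> bounds the value on both sides.\<close>

lemma global_restriction_chain_product:
  assumes "i \<in> {1..a}" "j \<in> {1..b}"
  shows "box_restriction a b c (i, j) = {int (i + j) - 1..int (i + j + c) - 1}"
proof (intro set_eqI iffI)
  fix k assume "k \<in> box_restriction a b c (i, j)"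
  then obtain g where g: "g \<in> chain_product a b \<rightarrow> {1..int (a + b + c - 1)}" "g (i, j) = k"
    and strict: "\<forall>p1\<in>chain_product a b. \<forall>p2\<in>chain_product a b. p1 < p2 \<longrightarrow> g p1 < g p2"
    by (auto simp: global_restriction_def)
  have mem: "(x, y) \<in> chain_product a b \<longleftrightarrow> x \<in> {1..a} \<and> y \<in> {1..b}" for x y
    by (auto simp: chain_product_def)
  have row: "g (x, y) - int x \<le> g (x', y) - int x'"
    if "x \<le> x'" "1 \<le> x" "x' \<le> a" "y \<in> {1..b}" for x x' y
    using that(1,3)
  proof (induction x' rule: dec_induct)
    case (step n)
    have "g (n, y) < g (Suc n, y)"
      using step that by (intro strict[rule_format]) (auto simp: mem less_nat_prod_iff)
    then show ?case using step by auto
  qed simp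
  have col: "g (x, y) - int y \<le> g (x, y') - int y'"
    if "y \<le> y'" "1 \<le> y" "y' \<le> b" "x \<in> {1..a}" for x y y'
    using that(1,3)
  proof (induction y' rule: dec_induct)
    case (step n)
    have "g (x, n) < g (x, Suc n)"
      using step that by (intro strict[rule_format]) (auto simp: mem less_nat_prod_iff)
    then show ?case using step by auto
  qed simp
  have "1 \<le> g (1, 1)" "g (a, b) \<le> int (a + b + c - 1)"
    using g(1) assms by (auto simp: mem Pi_iff)
  then show "k \<in> {int (i + j) - 1..int (i + j + c) - 1}"
    using row[of 1 i 1] col[of 1 j i] row[of i a j] col[of j b a] assms g(2) by auto
next
  fix k assume k: "k \<in> {int (i + j) - 1..int (i + j + c) - 1}"
  \<comment> \<open>A translate of the rank function attains \<open>k\<close>; the bounds on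
    \<open>k\<close> are what keeps its extreme values, at \<open>(1, 1)\<close> and
    \<open>(a, b)\<close>, in range.\<close>
  define g where "g = (\<lambda>p. int (fst p + snd p) + (k - int (i + j)))"
  have "g \<in> chain_product a b \<rightarrow> {1..int (a + b + c - 1)}"
    using k assms by (auto simp: g_def chain_product_def)
  moreover have "g p1 < g p2" if "p1 < p2" for p1 p2
    using that by (cases p1; cases p2) (auto simp: g_def less_nat_prod_iff)
  moreover have "g (i, j) = k" by (simp add: g_def)
  ultimately show "k \<in> box_restriction a b c (i, j)"
    by (auto simp: global_restriction_def)
qed

text \<open>Strictness comes from the rank \<open>fst p + snd p\<close> alone; the threshold counts
  increase only weakly.\<close>

lemma decode_strict_labelings:
  assumes h: "h \<in> box_states a b c l"
  shows "decode a b c l h \<in> strict_labelings (chain_product a b) l (box_restriction a b c)"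
proof -
  let ?f = "decode a b c l h"
  let ?S = "\<lambda>p t. {m \<in> {1..c}. int l < int t + h (p, m)}"
  have "?f (p1, t) < ?f (p2, t)"
    if p: "p1 \<in> chain_product a b" "p2 \<in> chain_product a b" and t: "t \<in> {1..l}" and less: "p1 < p2" for p1 p2 t
  proof -
    obtain i j i' j' where ij: "p1 = (i, j)" "p2 = (i', j')" by (cases p1, cases p2) auto
    have le: "i \<le> i'" "j \<le> j'" "i + j < i' + j'"
      using less ij by (auto simp: less_nat_prod_iff)
    have "h (p1, m) \<le> h (p2, m)" if "m \<in> {1..c}" for m
      using box_mono_row[OF h le(1), of j m] box_mono_column[OF h le(2), of i' m] p ij that
      by (auto simp: mem_box chain_product_def)
    then have "?S p1 t \<subseteq> ?S p2 t" by force
    from card_mono[OF _ this] show ?thesis using p t ij le by (simp add: decode_def)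
  qed
  moreover have "?f (p, t) \<le> ?f (p, t')"
    if "p \<in> chain_product a b" "t \<in> {1..l}" "t' \<in> {1..l}" "t \<le> t'" for p t t'
  proof -
    have "?S p t \<subseteq> ?S p t'" using that by auto
    from card_mono[OF _ this] show ?thesis using that by (simp add: decode_def)
  qed
  moreover have "?f (p, t) \<in> box_restriction a b c p"
    if "p \<in> chain_product a b" "t \<in> {1..l}" for p t
    using decode_bounds[of "fst p" "snd p" a b t l c h] global_restriction_chain_product[of "fst p" a "snd p" b c] that
    by (auto simp: chain_product_def)
  moreover have "?f \<in> extensional (chain_product a b \<times> {1..l})"
    by (auto simp: decode_def extensional_def)
  ultimately show ?thesis by (simp add: strict_labelings_def)
qed

lemma card_top_positions:
  assumes "0 \<le> v" "v \<le> int l"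
  shows "card {t \<in> {1..l}. int l < int t + v} = nat v"
proof -
  have "{t \<in> {1..l}. int l < int t + v} = {l + 1 - nat v..l}" using assms by auto
  then show ?thesis using assms by simp
qed

text \<open>The value at a point is the number of positions in its fiber whose label meets its
  threshold.\<close>

lemma inj_on_decode: "inj_on (decode a b c l) (box_states a b c l)"
proof (rule inj_onI)
  fix h h' assume h: "h \<in> box_states a b c l" "h' \<in> box_states a b c l"
    and eq: "decode a b c l h = decode a b c l h'"
  show "h = h'"
  proof (rule PiE_ext[of _ "box a b c" "\<lambda>_. {0..int l}"])
    show "h \<in> box a b c \<rightarrow>\<^sub>E {0..int l}" "h' \<in> box a b c \<rightarrow>\<^sub>E {0..int l}"
      using h by (auto simp: states_def)
    fix x assume x: "x \<in> box a b c"
    obtain i j m where ijm: "x = ((i, j), m)" by (rule triple_cases)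
    have "int l < int t + h x \<longleftrightarrow> int l < int t + h' x" if "t \<in> {1..l}" for t
      using decode_ge_iff[OF h(1) x[unfolded ijm] that] decode_ge_iff[OF h(2) x[unfolded ijm] that]
      unfolding eq ijm by blast
    then have "{t \<in> {1..l}. int l < int t + h x} = {t \<in> {1..l}. int l < int t + h' x}" by blast
    moreover have "0 \<le> h x" "h x \<le> int l" "0 \<le> h' x" "h' x \<le> int l"
      using state_range[OF h(1) x] state_range[OF h(2) x] by auto
    ultimately show "h x = h' x"
      using card_top_positions[of "h x" l] card_top_positions[of "h' x" l] by simp
  qed
qed

lemma threshold_position:
  assumes mono: "\<And>t t'. t \<in> {1..l} \<Longrightarrow> t' \<in> {1..l} \<Longrightarrow> t \<le> t' \<Longrightarrow> Q t \<Longrightarrow> Q t'"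
    and t: "t \<in> {1..l}"
  shows "int l < int t + int (card {t \<in> {1..l}. Q t}) \<longleftrightarrow> Q t"
proof -
  have "l + 1 - t \<le> card {t \<in> {1..l}. Q t} \<longleftrightarrow> Q t"
    by (rule card_upper_set_ge_iff[OF _ t]) (rule mono; simp)
  moreover have "int l < int t + int n \<longleftrightarrow> l + 1 - t \<le> n" for n using t by auto
  ultimately show ?thesis by blast
qed

lemma decode_surj:
  assumes f: "f \<in> strict_labelings (chain_product a b) l (box_restriction a b c)"
  shows "f \<in> decode a b c l ` box_states a b c l"
proof -
  let ?T = "\<lambda>p m. {t \<in> {1..l}. int (fst p + snd p + c) - int m \<le> f (p, t)}"
  define h where "h = restrict (\<lambda>(p, m). int (card (?T p m))) (box a b c)"
  have strict: "f (p, t) < f (p', t)"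
    if "p \<in> chain_product a b" "p' \<in> chain_product a b" "t \<in> {1..l}" "p < p'" for p p' t
    using f that by (auto simp: strict_labelings_def)
  have mono: "f (p, t) \<le> f (p, t')"
    if "p \<in> chain_product a b" "t \<in> {1..l}" "t' \<in> {1..l}" "t \<le> t'" for p t t'
    using f that by (auto simp: strict_labelings_def)
  have R: "int (i + j) - 1 \<le> f ((i, j), t) \<and> f ((i, j), t) \<le> int (i + j + c) - 1"
    if "(i, j) \<in> chain_product a b" "t \<in> {1..l}" for i j t
  proof -
    have "f ((i, j), t) \<in> box_restriction a b c (i, j)" using f that by (auto simp: strict_labelings_def)
    then show ?thesis using that global_restriction_chain_product[of i a j b c] by (auto simp: chain_product_def)
  qed
  have h: "h \<in> box_states a b c l"
  proof -
    have "card (?T p m) \<le> l" for p m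
    proof -
      have "?T p m \<subseteq> {1..l}" by blast
      from card_mono[OF _ this] show ?thesis by simp
    qed
    moreover have "card (?T p m) \<le> card (?T p' m')"
      if xy: "(p, m) \<in> box a b c" "(p', m') \<in> box a b c" "box_cover (p, m) (p', m')" for p m p' m'
    proof -
      have "?T p m \<subseteq> ?T p' m'"
      proof
        fix t assume t: "t \<in> ?T p m"
        obtain i j i' j' where ij: "p = (i, j)" "p' = (i', j')" by (cases p, cases p') auto
        show "t \<in> ?T p' m'"
        proof (cases "p = p'")
          case True
          then show ?thesis using xy ij t by auto
        next
          case False
          \<comment> \<open>Moving along a chain of the poset raises the threshold by one, which the
            strictness of \<open>f\<close> makes up for.\<close>
          then have "p < p'" using xy ij by (auto simp: less_nat_prod_iff)
          then show ?thesis using strict[of p p' t] xy ij t False by (auto simp: box_def)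
        qed
      qed
      then show ?thesis by (intro card_mono) auto
    qed
    ultimately show ?thesis by (auto simp: states_def h_def)
  qed
  have "f (p, t) = decode a b c l h (p, t)" for p t
  proof (cases "p \<in> chain_product a b \<and> t \<in> {1..l}")
    case True
    obtain i j where ij: "p = (i, j)" by (cases p)
    have iff: "int (i + j + c) - int m \<le> f (p, t) \<longleftrightarrow> int (i + j + c) - int m \<le> decode a b c l h (p, t)"
      if "m \<in> {1..c}" for m
    proof -
      have x: "((i, j), m) \<in> box a b c" using True that ij by (auto simp: mem_box chain_product_def)
      have "int l < int t + int (card (?T p m)) \<longleftrightarrow> int (fst p + snd p + c) - int m \<le> f (p, t)"
        by (rule threshold_position) (use True mono order_trans in blast)+
      then show ?thesis using decode_ge_iff[OF h x, of t] True ij x by (simp add: h_def)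
    qed
    let ?g = "decode a b c l h (p, t)"
    have b: "int (i + j) - 1 \<le> f (p, t)" "f (p, t) \<le> int (i + j + c) - 1"
      "int (i + j) - 1 \<le> ?g" "?g \<le> int (i + j + c) - 1"
      using R[of i j t] decode_bounds[of i j a b t l c h] True ij by auto
    \<comment> \<open>Every value in the range except the least is itself a threshold, namely the
      one with \<open>m = i + j + c - x\<close>; the least is covered by the lower bound on
      \<open>y\<close>.\<close>
    have le: "x \<le> y"
      if "int (i + j) - 1 \<le> x" "x \<le> int (i + j + c) - 1" "int (i + j) - 1 \<le> y"
        "\<And>m. m \<in> {1..c} \<Longrightarrow> int (i + j + c) - int m \<le> x \<Longrightarrow> int (i + j + c) - int m \<le> y" for x y
    proof (cases "x = int (i + j) - 1")
      case False
      then have "nat (int (i + j + c) - x) \<in> {1..c}" "int (nat (int (i + j + c) - x)) = int (i + j + c) - x"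
        using that(1,2) by auto
      then show ?thesis using that(4) by fastforce
    qed (use that in simp)
    show ?thesis
    proof (rule antisym)
      show "f (p, t) \<le> ?g" by (rule le[OF b(1-3)]) (use iff in blast)
      show "?g \<le> f (p, t)" by (rule le[OF b(3,4,1)]) (use iff in blast)
    qed
  next
    case False
    then have "f (p, t) = undefined"
      using f by (intro extensional_arb[of f "chain_product a b \<times> {1..l}"])
        (simp_all add: strict_labelings_def)
    then show ?thesis using False by (auto simp: decode_def)
  qed
  then have "f = decode a b c l h" by auto
  then show ?thesis using h by blast
qed

lemma bij_betw_decode:
  "bij_betw (decode a b c l) (box_states a b c l)
    (strict_labelings (chain_product a b) l (box_restriction a b c))"
  unfolding bij_betw_def using inj_on_decode decode_strict_labelings decode_surj by blast

section \<open>Bender--Knuth involutions as toggles\<close>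

lemma independent_level: "independent box_cover {x \<in> box a b c. box_height c x = k}"
  by (rule independent_same_parity[OF height_box]) auto

section \<open>Label windows and free positions\<close>

lemma decode_cong_fiber:
  assumes "\<And>m. m \<in> {1..c} \<Longrightarrow> int l < int t + h (p, m) \<longleftrightarrow> int l < int t + h' (p, m)"
  shows "decode a b c l h (p, t) = decode a b c l h' (p, t)"
proof -
  have "{m \<in> {1..c}. int l < int t + h (p, m)} = {m \<in> {1..c}. int l < int t + h' (p, m)}"
    using assms by blast
  then show ?thesis by (simp add: decode_def)
qed

text \<open>The adjacent thresholds, or the ends of the label range when \<open>m\<close> is
  \<open>c\<close> or \<open>1\<close>, leave two candidate labels; threshold \<open>m\<close>
  chooses between them.\<close>

lemma decode_window:
  assumes h: "h \<in> box_states a b c l" and x: "((i, j), m) \<in> box a b c" and t: "t \<in> {1..l}"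
    and up: "m < c \<Longrightarrow> int l < int t + h ((i, j), Suc m)"
    and down: "1 < m \<Longrightarrow> int t + h ((i, j), m - 1) \<le> int l"
  shows "decode a b c l h ((i, j), t) =
    int (i + j + c) - int m - (if int l < int t + h ((i, j), m) then 0 else 1)"
proof -
  let ?f = "decode a b c l h ((i, j), t)"
  have ij: "(i, j) \<in> chain_product a b" and m: "1 \<le> m" "m \<le> c" using x by (auto simp: box_def)
  have "int (i + j + c) - int m - 1 \<le> ?f"
  proof (cases "m < c")
    case True
    then have "((i, j), Suc m) \<in> box a b c" using x by (simp add: mem_box)
    from decode_ge_iff[OF h this t] up[OF True] show ?thesis by simp
  qed (use decode_bounds(1)[OF ij t, of c h] m in auto)
  moreover have "?f \<le> int (i + j + c) - int m"
  proof (cases "1 < m")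
    case True
    then have "((i, j), m - 1) \<in> box a b c" using x by (auto simp: mem_box)
    from decode_ge_iff[OF h this t] down[OF True] True show ?thesis by (simp add: of_nat_diff)
  qed (use decode_bounds(2)[OF ij t, of c h] m in auto)
  ultimately show ?thesis using decode_ge_iff[OF h x t] by auto
qed

lemma states_update:
  assumes "h \<in> box_states a b c l" "x \<in> box a b c"
    and "toggle_bot (box a b c) box_cover h x \<le> w"
    and "w \<le> toggle_top (box a b c) box_cover (int l) h x"
  shows "h(x := w) \<in> box_states a b c l"
proof -
  have "(\<lambda>y. if y \<in> {x} then w else h y) \<in> box_states a b c l"
    by (rule states_replace[OF finite_box assms(1)])
      (use assms box_cover_irrefl in \<open>auto simp: independent_def\<close>)
  then show ?thesis by (simp add: fun_upd_def)
qed

text \<open>Raising the label at \<open>t\<close> past threshold \<open>m\<close> is blocked exactly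
  by an upper cover whose own threshold is not met at \<open>t\<close>: in another fiber strictness
  would fail.\<close>

lemma raisable_decode_iff:
  assumes h: "h \<in> box_states a b c l" and x: "((i, j), m) \<in> box a b c" and t: "t \<in> {1..l}"
    and eq: "decode a b c l h ((i, j), t) = int (i + j + c) - int m - 1"
  shows "raisable (chain_product a b) l (box_restriction a b c) (decode a b c l h) (i, j) t \<longleftrightarrow>
    int l < int t + toggle_top (box a b c) box_cover (int l) h ((i, j), m)"
    (is "?raise \<longleftrightarrow> int l < int t + ?U")
proof
  let ?P = "chain_product a b"
  let ?f = "decode a b c l h"
  assume ?raise
  then obtain g where g: "g \<in> strict_labelings ?P l (box_restriction a b c)"
    and gt: "?f ((i, j), t) < g ((i, j), t)"
    and same: "\<And>p t. p \<in> ?P \<Longrightarrow> t \<in> {1..l} \<Longrightarrow> p \<noteq> (i, j) \<Longrightarrow> ?f (p, t) = g (p, t)"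
    unfolding raisable_def by blast
  have "int l - int t < h y" if y: "y \<in> box a b c" "box_cover ((i, j), m) y" for y
  proof -
    obtain i' j' m' where y': "y = ((i', j'), m')" by (rule triple_cases)
    have "int (i' + j' + c) - int m' \<le> ?f ((i', j'), t)"
    proof (cases "(i', j') = (i, j)")
      case True
      then show ?thesis using y y' eq by auto
    next
      case False
      then have "(i, j) < (i', j')" using y(2) y' by (auto simp: less_nat_prod_iff)
      moreover have "(i, j) \<in> ?P" "(i', j') \<in> ?P" using x y(1) y' by (auto simp: box_def)
      ultimately have "g ((i, j), t) < g ((i', j'), t)"
        using g t by (auto simp: strict_labelings_def)
      then have "g ((i, j), t) < ?f ((i', j'), t)"
        using same[OF \<open>(i', j') \<in> ?P\<close> t False] by simp
      then show ?thesis using gt eq False y(2) y' by auto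
    qed
    then show ?thesis using decode_ge_iff[OF h y(1)[unfolded y'] t] y' by simp
  qed
  then have "int l - int t < ?U" using t by (simp add: less_toggle_top_iff[OF finite_box])
  then show "int l < int t + ?U" by simp
next
  let ?P = "chain_product a b"
  let ?f = "decode a b c l h"
  assume U: "int l < int t + ?U"
  \<comment> \<open>The least count that includes position \<open>t\<close>.\<close>
  define h' where "h' = h(((i, j), m) := int l + 1 - int t)"
  have "\<not> int l < int t + h ((i, j), m)" using decode_ge_iff[OF h x t] eq by simp
  then have h': "h' \<in> box_states a b c l"
    unfolding h'_def using U state_bounds(1)[OF finite_box h x]
    by (intro states_update[OF h x]) auto
  have "?f ((i, j), t) < decode a b c l h' ((i, j), t)"
    using decode_ge_iff[OF h' x t] eq by (simp add: h'_def)
  moreover have "?f (p, t') = decode a b c l h' (p, t')" if "p \<noteq> (i, j)" for p t'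
    by (rule decode_cong_fiber) (use that in \<open>auto simp: h'_def\<close>)
  ultimately show ?raise
    unfolding raisable_def using decode_strict_labelings[OF h'] by blast
qed

lemma lowerable_decode_iff:
  assumes h: "h \<in> box_states a b c l" and x: "((i, j), m) \<in> box a b c" and t: "t \<in> {1..l}"
    and eq: "decode a b c l h ((i, j), t) = int (i + j + c) - int m"
  shows "lowerable (chain_product a b) l (box_restriction a b c) (decode a b c l h) (i, j) t \<longleftrightarrow>
    int t + toggle_bot (box a b c) box_cover h ((i, j), m) \<le> int l"
    (is "?lower \<longleftrightarrow> int t + ?L \<le> int l")
proof
  let ?P = "chain_product a b"
  let ?f = "decode a b c l h"
  assume ?lower
  then obtain g where g: "g \<in> strict_labelings ?P l (box_restriction a b c)"
    and gt: "g ((i, j), t) < ?f ((i, j), t)"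
    and same: "\<And>p t. p \<in> ?P \<Longrightarrow> t \<in> {1..l} \<Longrightarrow> p \<noteq> (i, j) \<Longrightarrow> ?f (p, t) = g (p, t)"
    unfolding lowerable_def by blast
  have "h y \<le> int l - int t" if y: "y \<in> box a b c" "box_cover y ((i, j), m)" for y
  proof -
    obtain i' j' m' where y': "y = ((i', j'), m')" by (rule triple_cases)
    have "?f ((i', j'), t) < int (i' + j' + c) - int m'"
    proof (cases "(i', j') = (i, j)")
      case True
      then show ?thesis using y y' eq by auto
    next
      case False
      then have "(i', j') < (i, j)" using y(2) y' by (auto simp: less_nat_prod_iff)
      moreover have "(i, j) \<in> ?P" "(i', j') \<in> ?P" using x y(1) y' by (auto simp: box_def)
      ultimately have "g ((i', j'), t) < g ((i, j), t)"
        using g t by (auto simp: strict_labelings_def)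
      then have "?f ((i', j'), t) < g ((i, j), t)"
        using same[OF \<open>(i', j') \<in> ?P\<close> t False] by simp
      then show ?thesis using gt eq False y(2) y' by auto
    qed
    then show ?thesis using decode_ge_iff[OF h y(1)[unfolded y'] t] y' by simp
  qed
  then have "?L \<le> int l - int t" using t by (simp add: toggle_bot_le_iff[OF finite_box])
  then show "int t + ?L \<le> int l" by simp
next
  let ?P = "chain_product a b"
  let ?f = "decode a b c l h"
  assume L: "int t + ?L \<le> int l"
  \<comment> \<open>Dually, the largest count that leaves out position \<open>t\<close>.\<close>
  define h' where "h' = h(((i, j), m) := int l - int t)"
  have "int l < int t + h ((i, j), m)" using decode_ge_iff[OF h x t] eq by simp
  then have h': "h' \<in> box_states a b c l"
    unfolding h'_def using L state_bounds(2)[OF finite_box h x]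
    by (intro states_update[OF h x]) auto
  have "decode a b c l h' ((i, j), t) < ?f ((i, j), t)"
    using decode_ge_iff[OF h' x t] eq by (simp add: h'_def)
  moreover have "?f (p, t') = decode a b c l h' (p, t')" if "p \<noteq> (i, j)" for p t'
    by (rule decode_cong_fiber) (use that in \<open>auto simp: h'_def\<close>)
  ultimately show ?lower
    unfolding lowerable_def using decode_strict_labelings[OF h'] by blast
qed

lemma next_label_interval:
  assumes "x \<le> k" "k < y"
  shows "next_label {x..y} k = k + 1"
  unfolding next_label_def by (rule Min_eqI) (use assms in \<open>auto intro: finite_subset[of _ "{x..y}"]\<close>)

text \<open>Each kind of free label supplies one end of the window; the other end follows because
  \<open>h\<close> lies between its two bounds.\<close>

lemma free_positions_decode:
  assumes h: "h \<in> box_states a b c l" and x: "((i, j), m) \<in> box a b c"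
    and k: "k = int (i + j + c) - int m - 1"
  shows "free_positions (chain_product a b) l (box_restriction a b c) k (decode a b c l h) (i, j) =
    {t \<in> {1..l}. int l < int t + toggle_top (box a b c) box_cover (int l) h ((i, j), m) \<and>
      int t + toggle_bot (box a b c) box_cover h ((i, j), m) \<le> int l}"
    (is "?F = {t \<in> {1..l}. int l < int t + ?U \<and> int t + ?L \<le> int l}")
proof (rule set_eqI)
  fix t
  let ?f = "decode a b c l h"
  have ij: "i \<in> {1..a}" "j \<in> {1..b}" "m \<in> {1..c}" using x by (auto simp: mem_box)
  note R = global_restriction_chain_product[OF ij(1,2), of c]
  have kR: "k \<in> box_restriction a b c (i, j)" "k + 1 \<in> box_restriction a b c (i, j)"
    using k ij(3) unfolding R by auto
  have nl: "next_label (box_restriction a b c (i, j)) k = int (i + j + c) - int m"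
    using k ij(3) unfolding R by (subst next_label_interval) auto
  have free: "t \<in> ?F \<longleftrightarrow> t \<in> {1..l} \<and>
    (?f ((i, j), t) = int (i + j + c) - int m - 1 \<and>
        raisable (chain_product a b) l (box_restriction a b c) ?f (i, j) t \<or>
      ?f ((i, j), t) = int (i + j + c) - int m \<and>
        lowerable (chain_product a b) l (box_restriction a b c) ?f (i, j) t)"
    using kR unfolding free_positions_def nl by (auto simp: k intro!: bexI[of _ "k + 1"])
  show "t \<in> ?F \<longleftrightarrow> t \<in> {t \<in> {1..l}. int l < int t + ?U \<and> int t + ?L \<le> int l}"
  proof (cases "t \<in> {1..l}")
    case t: True
    note ge = decode_ge_iff[OF h x t]
    note v = state_bounds[OF finite_box h x]
    have window: "?f ((i, j), t) =
        int (i + j + c) - int m - (if int l < int t + h ((i, j), m) then 0 else 1)"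
      if "int l < int t + ?U" "int t + ?L \<le> int l"
    proof (rule decode_window[OF h x t])
      assume "m < c"
      then have "?U \<le> h ((i, j), Suc m)"
        using ij by (intro toggle_top_le[OF finite_box]) (auto simp: mem_box)
      then show "int l < int t + h ((i, j), Suc m)" using that by simp
    next
      assume "1 < m"
      then have "h ((i, j), m - 1) \<le> ?L"
        using ij by (intro toggle_bot_ge[OF finite_box]) (auto simp: mem_box)
      then show "int t + h ((i, j), m - 1) \<le> int l" using that by simp
    qed
    show ?thesis
    proof
      assume "t \<in> ?F"
      then consider "?f ((i, j), t) = int (i + j + c) - int m - 1" "int l < int t + ?U"
        | "?f ((i, j), t) = int (i + j + c) - int m" "int t + ?L \<le> int l"
        using free raisable_decode_iff[OF h x t] lowerable_decode_iff[OF h x t] by blast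
      then show "t \<in> {t \<in> {1..l}. int l < int t + ?U \<and> int t + ?L \<le> int l}"
        using t ge v by cases auto
    next
      assume "t \<in> {t \<in> {1..l}. int l < int t + ?U \<and> int t + ?L \<le> int l}"
      then have UL: "int l < int t + ?U" "int t + ?L \<le> int l" by auto
      then show "t \<in> ?F"
        using window[OF UL] free t raisable_decode_iff[OF h x t] lowerable_decode_iff[OF h x t]
        by (cases "int l < int t + h ((i, j), m)") auto
    qed
  qed (use free in auto)
qed

text \<open>With bounds \<open>L\<close>, \<open>U\<close> and count \<open>v\<close>, the window
  holds \<open>U - v\<close> labels \<open>k\<close> followed by \<open>v - L\<close> labels
  \<open>k + 1\<close>. After the exchange the larger label starts at position
  \<open>l + 1 - (U + L - v)\<close>, so the new count is the toggled one. A fiber meets each level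
  at most once, so fibers can be treated separately.\<close>

lemma bender_knuth_decode:
  assumes h: "h \<in> box_states a b c l"
  shows "bender_knuth (chain_product a b) l (box_restriction a b c) (int k) (decode a b c l h) =
    decode a b c l (toggle_on (box a b c) box_cover (int l) {x \<in> box a b c. box_height c x = k} h)"
    (is "?B = decode a b c l ?h'")
proof (rule ext)
  fix pt :: "(nat \<times> nat) \<times> nat"
  obtain i j t where pt: "pt = ((i, j), t)" by (rule triple_cases)
  let ?P = "chain_product a b" and ?f = "decode a b c l h"
  let ?F = "free_positions ?P l (box_restriction a b c) (int k) ?f (i, j)"
  consider "(i, j) \<notin> ?P \<or> t \<notin> {1..l}"
    | "(i, j) \<in> ?P" "t \<in> {1..l}" "\<And>m. m \<in> {1..c} \<Longrightarrow> i + j + c - 1 - m \<noteq> k"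
    | m where "(i, j) \<in> ?P" "t \<in> {1..l}" "m \<in> {1..c}" "i + j + c - 1 - m = k"
    by blast
  then show "?B pt = decode a b c l ?h' pt"
  proof cases
    case 1
    moreover have "?F \<subseteq> {1..l}" by (auto simp: free_positions_def)
    ultimately show ?thesis
      unfolding pt by (auto simp: bender_knuth_def Let_def decode_def)
  next
    case 2
    \<comment> \<open>A free label needs both \<open>k\<close> and a larger label in the label set,
      which forces some \<open>m\<close> with height \<open>k\<close>.\<close>
    have "?F = {}"
    proof (rule ccontr)
      assume "?F \<noteq> {}"
      then have "int k \<in> box_restriction a b c (i, j)" "\<exists>x\<in>box_restriction a b c (i, j). int k < x"
        by (auto simp: free_positions_def)
      then have "i + j \<le> k + 1" "k + 1 < i + j + c"
        using 2(1) global_restriction_chain_product[of i a j b c] by (auto simp: chain_product_def)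
      then have "1 \<le> i + j + c - 1 - k" "i + j + c - 1 - k \<le> c"
        and eq: "i + j + c - 1 - (i + j + c - 1 - k) = k"
        by linarith+
      then have m: "i + j + c - 1 - k \<in> {1..c}" by simp
      from 2(3)[OF m] eq show False by contradiction
    qed
    then have "?B pt = ?f pt" unfolding pt by (simp add: bender_knuth_def)
    also have "\<dots> = decode a b c l ?h' pt"
      unfolding pt by (rule decode_cong_fiber) (use 2 in \<open>auto simp: toggle_on_def\<close>)
    finally show ?thesis .
  next
    case (3 m)
    define U where "U = toggle_top (box a b c) box_cover (int l) h ((i, j), m)"
    define L where "L = toggle_bot (box a b c) box_cover h ((i, j), m)"
    define v where "v = h ((i, j), m)"
    define h' where "h' = ?h'"
    define F where "F = ?F"
    have x: "((i, j), m) \<in> box a b c" using 3 by (simp add: box_def)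
    then have ij: "i \<in> {1..a}" "j \<in> {1..b}" by (auto simp: mem_box)
    have k: "int k = int (i + j + c) - int m - 1" using 3 ij by auto
    have F: "t' \<in> F \<longleftrightarrow> t' \<in> {1..l} \<and> int l < int t' + U \<and> int t' + L \<le> int l" for t'
      unfolding F_def U_def L_def free_positions_decode[OF h x k] by blast
    have Lv: "L \<le> v" and vU: "v \<le> U"
      unfolding U_def L_def v_def by (rule state_bounds[OF finite_box h x])+
    have UL: "0 \<le> L" "U \<le> int l"
      unfolding U_def L_def by (simp_all add: toggle_bot_nonneg toggle_top_le_bound finite_box)
    have h': "h' \<in> box_states a b c l" unfolding h'_def
      by (rule toggle_on_states[OF finite_box h _ independent_level]) auto
    have h'm: "h' ((i, j), m) = U + L - v"
      using x 3 by (simp add: toggle_on_def h'_def U_def L_def v_def)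
    have h'o: "h' ((i, j), m') = h ((i, j), m')" if "m' \<in> {1..c}" "m' \<noteq> m" for m'
      using that 3 ij by (auto simp: toggle_on_def h'_def)
    have nl: "next_label (box_restriction a b c (i, j)) (int k) = int k + 1"
      unfolding global_restriction_chain_product[OF ij]
      by (rule next_label_interval) (use k 3 in auto)
    have "?B ((i, j), t) = decode a b c l h' ((i, j), t)"
    proof (cases "t \<in> F")
      case False
      then have "?B ((i, j), t) = ?f ((i, j), t)"
        unfolding F_def by (simp add: bender_knuth_def Let_def)
      also have "\<dots> = decode a b c l h' ((i, j), t)"
      proof (rule decode_cong_fiber)
        fix m' assume m': "m' \<in> {1..c}"
        show "int l < int t + h ((i, j), m') \<longleftrightarrow> int l < int t + h' ((i, j), m')"
        proof (cases "m' = m")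
          case True
          \<comment> \<open>Both \<open>v\<close> and \<open>U + L - v\<close> lie between
            \<open>L\<close> and \<open>U\<close>, so outside the window the two counts agree on
            whether \<open>t\<close> is included.\<close>
          have "\<not> int l < int t + U \<or> \<not> int t + L \<le> int l" using False F 3(2) by blast
          then show ?thesis unfolding True h'm v_def[symmetric] using Lv vU by linarith
        next
          case False
          show ?thesis unfolding h'o[OF m' False] ..
        qed
      qed
      finally show ?thesis .
    next
      case True
      then have t: "int l < int t + U" "int t + L \<le> int l" unfolding F by blast+
      have up: "int l < int t' + h ((i, j), Suc m)" if "int l < int t' + U" "m < c" for t'
      proof -
        have "U \<le> h ((i, j), Suc m)"
          unfolding U_def using x that by (intro toggle_top_le[OF finite_box]) (auto simp: mem_box)
        then show ?thesis using that by linarith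
      qed
      have down: "int t' + h ((i, j), m - 1) \<le> int l" if "int t' + L \<le> int l" "1 < m" for t'
      proof -
        have "h ((i, j), m - 1) \<le> L"
          unfolding L_def using x that by (intro toggle_bot_ge[OF finite_box]) (auto simp: mem_box)
        then show ?thesis using that by linarith
      qed
      have "?f ((i, j), t') = int k + 1 \<longleftrightarrow> int l < int t' + v" if "t' \<in> F" for t'
      proof -
        have t': "t' \<in> {1..l}" "int l < int t' + U" "int t' + L \<le> int l"
          using that unfolding F by blast+
        have "?f ((i, j), t') = int (i + j + c) - int m - (if int l < int t' + v then 0 else 1)"
          unfolding v_def by (rule decode_window[OF h x t'(1)]) (fact up[OF t'(2)] down[OF t'(3)])+
        then show ?thesis unfolding k by simp
      qed
      then have "{t' \<in> F. ?f ((i, j), t') = int k + 1} = {t' \<in> F. int l < int t' + v}" by blast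
      also have "\<dots> = {l + 1 - nat v..l - nat L}" using Lv vU UL unfolding F by auto
      finally have \<beta>: "card {t' \<in> F. ?f ((i, j), t') = int k + 1} = nat (v - L)"
        using Lv vU UL by simp
      have "{t' \<in> F. t' < t} = {l + 1 - nat U..<t}" using t Lv vU UL 3(2) unfolding F by auto
      then have rank: "card {t' \<in> F. t' < t} = t - (l + 1 - nat U)" by simp
      have "?B ((i, j), t) = (if t - (l + 1 - nat U) < nat (v - L) then int k else int k + 1)"
        unfolding bender_knuth_def Let_def case_prod_conv nl F_def[symmetric] \<beta> rank
        using True 3(1) by simp
      also have "\<dots> = (if int l < int t + (U + L - v) then int k + 1 else int k)"
      proof -
        have "t - (l + 1 - nat U) < nat (v - L) \<longleftrightarrow> \<not> int l < int t + (U + L - v)"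
          using t Lv vU UL by linarith
        then show ?thesis by simp
      qed
      also have "\<dots> = decode a b c l h' ((i, j), t)"
      proof -
        have "int l < int t + h' ((i, j), Suc m)" if "m < c"
          using up[OF t(1) that] h'o[of "Suc m"] that by simp
        moreover have "int t + h' ((i, j), m - 1) \<le> int l" if "1 < m"
        proof -
          have "m - 1 \<in> {1..c}" "m - 1 \<noteq> m" using that 3(3) by auto
          from h'o[OF this] show ?thesis using down[OF t(2) that] by argo
        qed
        ultimately have "decode a b c l h' ((i, j), t) = int (i + j + c) - int m -
            (if int l < int t + h' ((i, j), m) then 0 else 1)"
          by (rule decode_window[OF h' x 3(2)])
        then show ?thesis unfolding h'm k by simp
      qed
      finally show ?thesis .
    qed
    then show ?thesis unfolding pt h'_def .
  qed
qed

section \<open>Promotion as a sweep, and the comparison of two boxes\<close>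

lemma Union_global_restriction:
  assumes "0 < a" "0 < b"
  shows "(\<Union>p\<in>chain_product a b. box_restriction a b c p) = {1..int (a + b + c - 1)}"
proof (rule set_eqI)
  fix k
  have "(\<Union>p\<in>chain_product a b. box_restriction a b c p) =
    (\<Union>p\<in>{1..a} \<times> {1..b}. {int (fst p + snd p) - 1..int (fst p + snd p + c) - 1})"
  proof (rule SUP_cong)
    show "box_restriction a b c p = {int (fst p + snd p) - 1..int (fst p + snd p + c) - 1}"
      if "p \<in> {1..a} \<times> {1..b}" for p
      using global_restriction_chain_product[of "fst p" a "snd p" b c] that by auto
  qed (simp add: chain_product_def)
  then have "k \<in> (\<Union>p\<in>chain_product a b. box_restriction a b c p) \<longleftrightarrow>
    (\<exists>i\<in>{1..a}. \<exists>j\<in>{1..b}. k \<in> {int (i + j) - 1..int (i + j + c) - 1})"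
    by auto
  also have "\<dots> \<longleftrightarrow> k \<in> {1..int (a + b + c - 1)}"
  proof
    assume k: "k \<in> {1..int (a + b + c - 1)}"
    consider "k \<le> int a" | "int a < k" "k \<le> int (a + b - 1)" | "int (a + b - 1) < k" by linarith
    then show "\<exists>i\<in>{1..a}. \<exists>j\<in>{1..b}. k \<in> {int (i + j) - 1..int (i + j + c) - 1}"
    proof cases
      case 1
      then show ?thesis using k assms by (intro bexI[of _ "nat k"] bexI[of _ 1]) auto
    next
      case 2
      then show ?thesis using k assms by (intro bexI[of _ a] bexI[of _ "nat (k + 1) - a"]) auto
    next
      case 3
      then show ?thesis using k assms by (intro bexI[of _ a] bexI[of _ b]) auto
    qed
  qed auto
  finally show "k \<in> (\<Union>p\<in>chain_product a b. box_restriction a b c p) \<longleftrightarrow>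
    k \<in> {1..int (a + b + c - 1)}" .
qed

lemma promotion_decode:
  assumes "0 < a" "0 < b" and h: "h \<in> box_states a b c l"
  shows "promotion (chain_product a b) l (box_restriction a b c) (decode a b c l h) =
    decode a b c l (sweep (box a b c) box_cover (int l) (box_height c) (a + b + c) h)"
proof -
  let ?B = "bender_knuth (chain_product a b) l (box_restriction a b c)"
  have "map int [1..<n + 1] = [1..int n]" for n
    by (induction n) (simp_all add: upto_rec2)
  from this[of "a + b + c - 1"] have upto: "[1..int (a + b + c - 1)] = map int [1..<a + b + c]"
    using assms(1) by simp
  have "fold (\<lambda>k. ?B (int k)) [1..<Suc N] (decode a b c l h) =
    decode a b c l (sweep (box a b c) box_cover (int l) (box_height c) (Suc N) h)" for N
  proof (induction N)
    case 0
    \<comment> \<open>The sweep begins with level 0 but promotion with index 1; the extra level is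
      empty because \<open>m \<le> c\<close> and \<open>i + j \<ge> 2\<close>.\<close>
    have "{x \<in> box a b c. box_height c x = 0} = {}"
      by (auto simp: mem_box)
    then show ?case by (simp add: sweep_def toggle_on_empty del: Collect_empty_eq)
  next
    case (Suc N)
    have "sweep (box a b c) box_cover (int l) (box_height c) (Suc N) h \<in> box_states a b c l"
      by (rule sweep_states[OF finite_box height_box h])
    from bender_knuth_decode[OF this, of "Suc N"] Suc show ?case by (simp add: sweep_def)
  qed
  from this[of "a + b + c - 1"]
  have "fold (\<lambda>k. ?B (int k)) [1..<a + b + c] (decode a b c l h) =
    decode a b c l (sweep (box a b c) box_cover (int l) (box_height c) (a + b + c) h)"
    using assms(1) by simp
  moreover have "promotion (chain_product a b) l (box_restriction a b c) =
      fold ?B [1..int (a + b + c - 1)]"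
  proof -
    have "1 \<le> int (a + b + c - 1)" using assms(1,2) by simp
    then have "Min {1..int (a + b + c - 1)} = 1"
        "Max {1..int (a + b + c - 1)} = int (a + b + c - 1)"
      by (intro Min_eqI Max_eqI; simp)+
    then show ?thesis
      by (simp only: promotion_def Union_global_restriction[OF assms(1,2)])
  qed
  ultimately show ?thesis by (simp only: upto fold_map comp_def)
qed

lemma equivariant_promotion_sweep:
  assumes "0 < a" "0 < b"
  shows "equivariant (box_states a b c l)
      (sweep (box a b c) box_cover (int l) (box_height c) (a + b + c))
      (strict_labelings (chain_product a b) l (box_restriction a b c))
      (promotion (chain_product a b) l (box_restriction a b c))"
  using bij_betw_decode promotion_decode[OF assms] unfolding equivariant_def by metis

text \<open>The change of height takes place inside the first box, where the second height is pulled
  back along \<open>\<sigma>\<close>; passing to the other box is then mere renaming.\<close>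

lemma equivariant_promotion:
  assumes pos: "0 < a" "0 < b" "0 < a'" "0 < b'"
    and \<sigma>: "bij_betw \<sigma> (box a b c) (box a' b' c')"
    and cover: "\<And>x y. box_cover x y \<longleftrightarrow> box_cover (\<sigma> x) (\<sigma> y)"
    and par: "\<And>x. x \<in> box a b c \<Longrightarrow> even (box_height c x + box_height c' (\<sigma> x) + d)"
  shows "\<exists>\<Psi>. promotion_equivariant_bij l (chain_product a b) (box_restriction a b c)
    (chain_product a' b') (box_restriction a' b' c') \<Psi>"
proof -
  let ?T = "sweep (box a b c) box_cover (int l) (box_height c) (a + b + c)"
  let ?T' = "sweep (box a' b' c') box_cover (int l) (box_height c') (a' + b' + c')"
  let ?S = "sweep (box a b c) box_cover (int l) (\<lambda>x. box_height c' (\<sigma> x)) (a' + b' + c')"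
  have bound: "box_height c x < a + b + c" if "x \<in> box a b c" for a b c x
    using that by (cases x rule: triple_cases) (auto simp: mem_box)
  have \<sigma>_mem: "\<sigma> x \<in> box a' b' c'" if "x \<in> box a b c" for x
    using \<sigma> that by (auto simp: bij_betw_def)
  have ht: "height (box a b c) box_cover (\<lambda>x. box_height c' (\<sigma> x))"
    using height_box[of a' b' c'] \<sigma>_mem cover unfolding height_def by blast
  have closed: "sweep (box a b c) box_cover (int l) u N \<in> box_states a b c l \<rightarrow> box_states a b c l"
    if "height (box a b c) box_cover u" for a b c u N
    using sweep_states[OF finite_box that] by blast
  have 1: "equivariant (strict_labelings (chain_product a b) l (box_restriction a b c))
      (promotion (chain_product a b) l (box_restriction a b c)) (box_states a b c l) ?T"
    by (rule equivariant_sym[OF equivariant_promotion_sweep closed]) (rule pos height_box)+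
  have 2: "equivariant (box_states a b c l) ?T (box_states a b c l) ?S"
    by (rule equivariant_sweeps[OF finite_box height_box ht par bound bound[OF \<sigma>_mem]])
  have "equivariant (box_states a' b' c' l) ?T' (box_states a b c l) ?S"
    by (rule equivariant_relabel[OF \<sigma>]) (rule cover)
  then have 3: "equivariant (box_states a b c l) ?S (box_states a' b' c' l) ?T'"
    by (rule equivariant_sym) (rule closed[OF height_box])
  note 4 = equivariant_promotion_sweep[OF pos(3,4), of c' l]
  show ?thesis
    using equivariant_trans[OF 1 equivariant_trans[OF 2 equivariant_trans[OF 3 4]]]
    unfolding equivariant_def promotion_equivariant_bij_def .
qed

theorem theorem3p7:
  fixes a b c l :: nat
  assumes "0 < a" and "0 < b" and "0 < c" and "0 < l"
  shows "(\<exists>\<Psi>. promotion_equivariant_bij l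
            (chain_product a b) (global_restriction (chain_product a b) (a + b + c - 1))
            (chain_product a c) (global_restriction (chain_product a c) (a + b + c - 1)) \<Psi>) \<and>
         (\<exists>\<Psi>. promotion_equivariant_bij l
            (chain_product a c) (global_restriction (chain_product a c) (a + b + c - 1))
            (chain_product b c) (global_restriction (chain_product b c) (a + b + c - 1)) \<Psi>) \<and>
         (\<exists>\<Psi>. promotion_equivariant_bij l
            (chain_product a b) (global_restriction (chain_product a b) (a + b + c - 1))
            (chain_product b c) (global_restriction (chain_product b c) (a + b + c - 1)) \<Psi>)"
proof -
  let ?\<sigma> = "\<lambda>((i, j), m). ((i, m), j)" and ?\<tau> = "\<lambda>((i, j), m). ((j, m), i)"
    and ?\<upsilon> = "\<lambda>((i, m), j). ((j, m), i)"
  have \<sigma>: "bij_betw ?\<sigma> (box a b c) (box a c b)"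
    by (rule bij_betwI[where g = ?\<sigma>]) (auto simp: mem_box)
  have \<upsilon>: "bij_betw ?\<upsilon> (box a c b) (box b c a)"
    by (rule bij_betwI[where g = ?\<upsilon>]) (auto simp: mem_box)
  have \<tau>: "bij_betw ?\<tau> (box a b c) (box b c a)"
    by (rule bij_betwI[where g = "\<lambda>((j, m), i). ((i, j), m)"]) (auto simp: mem_box)
  \<comment> \<open>The two heights sum to \<open>2 * i + b + c - 2\<close>, which dictates
    \<open>d = b + c\<close>; the other two cases have \<open>2 * m + a + b - 2\<close> and
    \<open>2 * j + a + c - 2\<close>.\<close>
  have "\<exists>\<Psi>. promotion_equivariant_bij l (chain_product a b) (box_restriction a b c)
      (chain_product a c) (box_restriction a c b) \<Psi>"
    by (rule equivariant_promotion[OF _ _ _ _ \<sigma>, where d = "b + c"])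
      (use assms in \<open>auto simp: mem_box\<close>)
  moreover have "\<exists>\<Psi>. promotion_equivariant_bij l (chain_product a c) (box_restriction a c b)
      (chain_product b c) (box_restriction b c a) \<Psi>"
    by (rule equivariant_promotion[OF _ _ _ _ \<upsilon>, where d = "a + b"])
      (use assms in \<open>auto simp: mem_box\<close>)
  moreover have "\<exists>\<Psi>. promotion_equivariant_bij l (chain_product a b) (box_restriction a b c)
      (chain_product b c) (box_restriction b c a) \<Psi>"
    by (rule equivariant_promotion[OF _ _ _ _ \<tau>, where d = "a + c"])
      (use assms in \<open>auto simp: mem_box\<close>)
  moreover have "a + c + b = a + b + c" "b + c + a = a + b + c" by simp_all
  ultimately show ?thesis by metis
qed

end
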